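(* Let $T$ be a tree with $n\ge 3$ vertices, let $w$ be a vertex of $T$ of degree $m\ge 2$, let $w_1,\dots,w_m$ be the neighbours of $w$, and let $T_1,\dots,T_m$ be the components of $T-w$, with $w_i\in V(T_i)$ regarded as the root of $T_i$. Let $l$ be the number of pendent vertices of $T$, and for each $i$ let $L_i$ be the set of pendent vertices of $T$ lying in $T_i$, $l_i=|L_i|$ (so $l_1+\cdots+l_m=l$), $TW(T_i)=\sum_{\{x,y\}\subseteq L_i} d(x,y)$ and $d'_{T_i}(w_i)=\sum_{x\in L_i} d(w_i,x)$. Then $$TW(T)=\sum_{i=1}^{m}\Big[TW(T_i)+(l-l_i)\,d'_{T_i}(w_i)-l_i^2\Big]+l^2 .$$
   Context: A pendent vertex is a vertex of degree $1$. For a tree $T$, $d(x,y)$ is the distance between $x$ and $y$, and the terminal Wiener index is $TW(T)=\sum d(x,y)$, the sum over all unordered pairs $\{x,y\}$ of distinct pendent vertices of $T$. *)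

theory Defs
  imports "Graph_Theory.Graph_Theory"
begin

text \<open>
  An undirected simple graph is a \<open>graph\<close>, i.e. a finite loop-free digraph without parallel arcs
  whose arc relation is symmetric; an edge is a pair of opposite arcs.
  The library's \<open>tree\<close> cannot be used for it: there the closed walk \<open>a, b, a\<close> along an edge and back
  counts as a cycle. In a simple graph the undirected cycles are the cycles of length at least 3.
\<close>

locale undirected_tree = graph +
  assumes connected: "Digraph_Component.connected G"
    and no_cycles: "cycle p \<Longrightarrow> length p < 3"

text \<open>The value for vertices not joined by a walk is irrelevant (\<open>Inf {} = 0\<close> on \<open>nat\<close>).\<close>

definition gdist :: "('a,'b) pre_digraph \<Rightarrow> 'a \<Rightarrow> 'a \<Rightarrow> nat" where
  "gdist G u v = (INF p \<in> {p. pre_digraph.awalk G u p v}. length p)"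

lemma (in wf_digraph) mu_eq_gdist:
  assumes "u \<rightarrow>\<^sup>* v"
  shows "\<mu> (\<lambda>_. 1) u v = ereal (real (gdist G u v))"
proof -
  let ?S = "length ` {p. awalk u p v}"
  have cost: "awalk_cost (\<lambda>_. 1) p = real (length p)" for p
    by (induct p) auto
  have "?S \<noteq> {}"
    using assms by (auto simp: reachable_awalk)
  then have "Inf ?S \<in> ?S"
    by (rule Inf_nat_def1)
  then obtain p where p: "awalk u p v" "length p = gdist G u v"
    by (auto simp: gdist_def)
  have le: "gdist G u v \<le> length q" if "awalk u q v" for q
    unfolding gdist_def by (rule cInf_lower) (use that in auto)
  show ?thesis
    unfolding \<mu>_def cost
  proof (rule antisym)
    show "(INF p\<in>{p. awalk u p v}. ereal (real (length p))) \<le> ereal (real (gdist G u v))"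
      by (rule INF_lower2[of p]) (use p in auto)
    show "ereal (real (gdist G u v)) \<le> (INF p\<in>{p. awalk u p v}. ereal (real (length p)))"
      by (rule INF_greatest) (use le in auto)
  qed
qed

lemma (in sym_digraph) awalk_reverse:
  assumes "awalk u p v"
  shows "\<exists>q. awalk v q u \<and> length q = length p"
  using assms
proof (induct p arbitrary: u)
  case Nil
  then show ?case by (intro exI[of _ "[]"]) (auto simp: awalk_Nil_iff)
next
  case (Cons e p)
  then have e: "e \<in> arcs G" "tail G e = u" and "awalk (head G e) p v"
    by (auto simp: awalk_Cons_iff)
  then obtain q where q: "awalk v q (head G e)" "length q = length p"
    using Cons by blast
  have "(u, head G e) \<in> arcs_ends G"
    using e by (auto simp: arcs_ends_def arc_to_ends_def)
  then have "(head G e, u) \<in> arcs_ends G"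
    by (rule graph_symmetric)
  then obtain e' where "e' \<in> arcs G" "tail G e' = head G e" "head G e' = u"
    by (auto simp: arcs_ends_def arc_to_ends_def)
  then have "awalk (head G e) [e'] u"
    by (auto simp: awalk_Cons_iff awalk_Nil_iff)
  with q show ?case
    by (intro exI[of _ "q @ [e']"]) auto
qed

lemma (in sym_digraph) gdist_sym: "gdist G u v = gdist G v u"
proof -
  have "length ` {p. awalk u p v} \<subseteq> length ` {p. awalk v p u}" for u v
  proof
    fix k assume "k \<in> length ` {p. awalk u p v}"
    then obtain p where p: "awalk u p v" "k = length p" by auto
    from awalk_reverse[OF p(1)] p(2) show "k \<in> length ` {p. awalk v p u}"
      by (metis (mono_tags, lifting) image_eqI mem_Collect_eq)
  qed
  then have "length ` {p. awalk u p v} = length ` {p. awalk v p u}"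
    by (intro antisym)
  then show ?thesis by (simp add: gdist_def)
qed

text \<open>The distance between the two elements of an unordered pair.\<close>

definition pair_dist :: "('a,'b) pre_digraph \<Rightarrow> 'a set \<Rightarrow> nat" where
  "pair_dist G e = (THE k. \<exists>x y. e = {x, y} \<and> k = gdist G x y)"

lemma (in sym_digraph) pair_dist_doubleton: "pair_dist G {x, y} = gdist G x y"
  unfolding pair_dist_def
  by (rule the_equality) (use gdist_sym in \<open>auto simp: doubleton_eq_iff\<close>)

definition pair_dist_sum :: "('a,'b) pre_digraph \<Rightarrow> 'a set \<Rightarrow> nat" where
  "pair_dist_sum G S = (\<Sum>e \<in> {{x, y} | x y. x \<in> S \<and> y \<in> S \<and> x \<noteq> y}. pair_dist G e)"

text \<open>As arcs come in opposite pairs, the degree of a vertex is its out-degree.\<close>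

definition pendents :: "('a,'b) pre_digraph \<Rightarrow> 'a set" where
  "pendents G = {v \<in> verts G. out_degree G v = 1}"

definition terminal_wiener :: "('a,'b) pre_digraph \<Rightarrow> nat" where
  "terminal_wiener G = pair_dist_sum G (pendents G)"

text \<open>
  For a symmetric digraph the strong components \<open>sccs\<close> are the components of the undirected graph.
\<close>

definition components_minus :: "('a,'b) pre_digraph \<Rightarrow> 'a \<Rightarrow> ('a,'b) pre_digraph set" where
  "components_minus G w = pre_digraph.sccs (pre_digraph.del_vert G w)"

end

theory Submission
  imports Defs
begin

text \<open>
  Pendent vertices \<open>x\<close> and \<open>y\<close> in different components \<open>T\<^sub>i\<close> and \<open>T\<^sub>j\<close> of \<open>T - w\<close> can only be joined
  through the edges \<open>w\<^sub>i w\<close> and \<open>w w\<^sub>j\<close>, so \<open>d(x,y) = d(w\<^sub>i,x) + d(w\<^sub>j,y) + 2\<close>; the formula follows by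
  summation over all ordered pairs. That \<open>w\<^sub>i\<close> is the only neighbour of \<open>w\<close> in \<open>T\<^sub>i\<close> follows from the
  indexing: distinct neighbours are roots of distinct, hence disjoint, components.
\<close>

section \<open>Sums over unordered and ordered pairs\<close>

lemma sum_unordered_pairs:
  fixes f :: "'a set \<Rightarrow> nat"
  assumes "finite S"
  shows "2 * sum f {{x, y} | x y. x \<in> S \<and> y \<in> S \<and> x \<noteq> y}
    = (\<Sum>x\<in>S. \<Sum>y\<in>S. if x = y then 0 else f {x, y})"
  using assms
proof (induction S)
  case empty
  then show ?case by simp
next
  case (insert a S)
  let ?P = "\<lambda>S. {{x, y} | x y. x \<in> S \<and> y \<in> S \<and> x \<noteq> y}"
  have split: "?P (insert a S) = ?P S \<union> (\<lambda>x. {a, x}) ` S"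
    using insert.hyps(2) by (auto simp: image_iff)
  have "?P S \<subseteq> Pow S" by auto
  then have fin: "finite (?P S)"
    by (rule finite_subset) (simp add: insert.hyps)
  have disj: "?P S \<inter> (\<lambda>x. {a, x}) ` S = {}"
    using insert.hyps(2) by (auto simp: doubleton_eq_iff)
  have inj: "inj_on (\<lambda>x. {a, x}) S"
    by (auto simp: inj_on_def doubleton_eq_iff)
  have "sum f (?P (insert a S)) = sum f (?P S) + (\<Sum>x\<in>S. f {a, x})"
    unfolding split
    by (subst sum.union_disjoint) (use fin disj insert.hyps inj in \<open>auto simp: sum.reindex\<close>)
  \<comment> \<open>Each new pair \<open>{a, x}\<close> occurs twice among the ordered pairs, once
    in the row and once in the column of \<open>a\<close>.\<close>
  moreover have "(\<Sum>y\<in>S. if a = y then 0 else f {a, y}) = (\<Sum>x\<in>S. f {a, x})"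
    "(\<Sum>x\<in>S. if x = a then 0 else f {x, a}) = (\<Sum>x\<in>S. f {a, x})"
    using insert.hyps(2) by (auto intro!: sum.cong simp: insert_commute)
  ultimately show ?case
    using insert by (simp add: sum.distrib)
qed

section \<open>Shortest walks and cut vertices\<close>

context wf_digraph
begin

lemma gdist_le: "awalk u p v \<Longrightarrow> gdist G u v \<le> length p"
  unfolding gdist_def by (rule cInf_lower) auto

lemma gdist_attained:
  assumes "u \<rightarrow>\<^sup>* v"
  obtains p where "awalk u p v" "length p = gdist G u v"
proof -
  have "length ` {p. awalk u p v} \<noteq> {}"
    using assms by (auto simp: reachable_awalk)
  then have "gdist G u v \<in> length ` {p. awalk u p v}"
    unfolding gdist_def by (rule Inf_nat_def1)
  then show thesis using that by auto
qed

lemma gdist_self: "u \<in> verts G \<Longrightarrow> gdist G u u = 0"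
  using gdist_le[of u "[]" u] by (simp add: awalk_Nil_iff)

lemma gdist_adj:
  assumes "u \<rightarrow> v" "u \<noteq> v"
  shows "gdist G u v = 1"
proof -
  from assms(1) obtain e where "e \<in> arcs G" "tail G e = u" "head G e = v"
    by (auto simp: arcs_ends_def arc_to_ends_def)
  then have "awalk u [e] v"
    using arc_implies_awalk by metis
  from gdist_le[OF this] have "gdist G u v \<le> 1" by simp
  moreover have "gdist G u v \<noteq> 0"
  proof
    assume "gdist G u v = 0"
    moreover obtain p where "awalk u p v" "length p = gdist G u v"
      using reachable_adjI[OF assms(1)] by (rule gdist_attained)
    ultimately show False using assms(2) by (simp add: awalk_Nil_iff)
  qed
  ultimately show ?thesis by simp
qed

text \<open>Cutting a shortest walk at \<open>c\<close> gives one inequality, joining shortest walks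
  at \<open>c\<close> the other. The pieces of the cut also witness the reachability that the second
  half needs.\<close>

lemma gdist_through:
  assumes "u \<rightarrow>\<^sup>* v" "\<And>p. awalk u p v \<Longrightarrow> c \<in> set (awalk_verts u p)"
  shows "gdist G u v = gdist G u c + gdist G c v"
proof (rule antisym)
  obtain p where p: "awalk u p v" "length p = gdist G u v"
    using assms(1) by (rule gdist_attained)
  from awalk_decomp[OF p(1) assms(2)[OF p(1)]]
  obtain q r where qr: "p = q @ r" "awalk u q c" "awalk c r v"
    by blast
  then show "gdist G u c + gdist G c v \<le> gdist G u v"
    using gdist_le[OF qr(2)] gdist_le[OF qr(3)] p(2) by simp
  obtain q' where q': "awalk u q' c" "length q' = gdist G u c"
    using reachable_awalkI[OF qr(2)] by (rule gdist_attained)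
  obtain r' where r': "awalk c r' v" "length r' = gdist G c v"
    using reachable_awalkI[OF qr(3)] by (rule gdist_attained)
  show "gdist G u v \<le> gdist G u c + gdist G c v"
    using gdist_le[OF awalk_appendI[OF q'(1) r'(1)]] q'(2) r'(2) by simp
qed

text \<open>Some arc of the walk must cross from \<open>A\<close> to its complement. Both its ends
  are recorded as lying on the walk, since either may turn out to be the cut vertex.\<close>

lemma awalk_leaves:
  assumes "awalk u p v" "u \<in> A" "v \<notin> A"
  shows "\<exists>x\<in>A. \<exists>y. y \<notin> A \<and> x \<rightarrow> y \<and> x \<in> set (awalk_verts u p) \<and> y \<in> set (awalk_verts u p)"
  using assms
proof (induction p arbitrary: u)
  case Nil
  then show ?case by (simp add: awalk_Nil_iff)
next
  case (Cons e p)
  from Cons.prems have e: "e \<in> arcs G" "tail G e = u" and walk: "awalk (head G e) p v"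
    by (auto simp: awalk_Cons_iff)
  have adj: "u \<rightarrow> head G e"
    using in_arcs_imp_in_arcs_ends[OF e(1)] e(2) by simp
  show ?case
  proof (cases "head G e \<in> A")
    case True
    from Cons.IH[OF walk this Cons.prems(3)] show ?thesis by auto
  next
    case False
    with adj Cons.prems(2) hd_in_awalk_verts(1)[OF walk] e(2) show ?thesis by auto
  qed
qed

end

section \<open>Components after deletion of a vertex\<close>

lemma (in sym_digraph) sym_digraph_del_vert: "sym_digraph (del_vert w)"
proof -
  interpret D: wf_digraph "del_vert w" by (rule wf_digraph_del_vert)
  show ?thesis
  proof
    show "symmetric (del_vert w)"
      unfolding symmetric_def
    proof (rule symI)
      fix a b assume "a \<rightarrow>\<^bsub>del_vert w\<^esub> b"
      then have "a \<rightarrow> b" "a \<noteq> w" "b \<noteq> w"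
        by (auto simp: arcs_ends_def arc_to_ends_def del_vert_simps)
      from graph_symmetric[OF this(1)] this(2,3) show "b \<rightarrow>\<^bsub>del_vert w\<^esub> a"
        by (fastforce simp: arcs_ends_def arc_to_ends_def del_vert_simps)
    qed
  qed
qed

lemma (in sym_digraph) scc_closed:
  assumes "c \<in> sccs" "u \<in> verts c" "u \<rightarrow> v"
  shows "v \<in> verts c"
proof -
  have "u \<rightarrow>\<^sup>* v" "v \<rightarrow>\<^sup>* u"
    using assms(3) graph_symmetric by auto
  moreover have "verts c \<in> sccs_verts"
    using assms(1) by (intro in_sccs_vertsI_sccs) simp
  ultimately show ?thesis
    using assms(2) by (auto simp: in_sccs_verts_conv_reachable)
qed

context sym_digraph
begin

text \<open>An arc avoiding \<open>w\<close> survives the deletion and so stays inside a component;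
  only a step to \<open>w\<close> can leave it.\<close>

lemma component_minus_exit:
  assumes "C \<in> components_minus G w" "x \<in> verts C" "x \<rightarrow> y" "y \<notin> verts C"
  shows "y = w"
proof (rule ccontr)
  assume "y \<noteq> w"
  interpret D: sym_digraph "del_vert w" by (rule sym_digraph_del_vert)
  have C: "C \<in> D.sccs" using assms(1) by (simp add: components_minus_def)
  then have "verts C \<subseteq> verts (del_vert w)"
    by (auto dest: D.in_sccs_imp_induced induced_imp_subgraph)
  with assms(2) have "x \<noteq> w" by (auto simp: del_vert_simps)
  with \<open>y \<noteq> w\<close> assms(3) have "x \<rightarrow>\<^bsub>del_vert w\<^esub> y"
    by (fastforce simp: arcs_ends_def arc_to_ends_def del_vert_simps)
  with D.scc_closed[OF C assms(2)] assms(4) show False by blast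
qed

lemma component_minus_subset:
  "C \<in> components_minus G w \<Longrightarrow> verts C \<subseteq> verts G - {w}"
proof -
  assume "C \<in> components_minus G w"
  then have "subgraph C (del_vert w)"
    unfolding components_minus_def
    by (auto dest: pre_digraph.in_sccs_imp_induced induced_imp_subgraph)
  then have "verts C \<subseteq> verts (del_vert w)" by auto
  then show ?thesis by (simp add: verts_del_vert)
qed

lemma components_minus_disjoint:
  assumes "C \<in> components_minus G w" "D \<in> components_minus G w" "C \<noteq> D"
  shows "verts C \<inter> verts D = {}"
  using wf_digraph.scc_disj[OF wf_digraph_del_vert] assms
  unfolding components_minus_def by blast

lemma components_minus_cover:
  assumes "v \<in> verts G" "v \<noteq> w"
  obtains C where "C \<in> components_minus G w" "v \<in> verts C"
  using sym_digraph.scc_for_vert_ex[OF sym_digraph_del_vert, of v w] assms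
  unfolding components_minus_def by (auto simp: del_vert_simps)

text \<open>A walk from \<open>x\<close> to \<open>w\<close> must leave \<open>C\<close>, and its
  last vertex before that exit is a neighbour of \<open>w\<close> in \<open>C\<close>, hence
  \<open>c\<close>. So \<open>c\<close> is a cut vertex, at distance 1 from
  \<open>w\<close>.\<close>

lemma gdist_to_deleted:
  assumes C: "C \<in> components_minus G w" and x: "x \<in> verts C"
    and c: "c \<in> verts C" "w \<rightarrow> c"
    and unique: "\<And>v. v \<in> verts C \<Longrightarrow> w \<rightarrow> v \<Longrightarrow> v = c"
    and reach: "x \<rightarrow>\<^sup>* w"
  shows "gdist G x w = gdist G c x + 1"
proof -
  have w: "w \<notin> verts C" using component_minus_subset[OF C] by auto
  have "c \<in> set (awalk_verts x p)" if p: "awalk x p w" for p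
  proof -
    obtain u v where "u \<in> verts C" "v \<notin> verts C" "u \<rightarrow> v" "u \<in> set (awalk_verts x p)"
      using awalk_leaves[OF p x w] by auto
    moreover from this have "v = w"
      using component_minus_exit[OF C] by blast
    ultimately show ?thesis
      using unique graph_symmetric by blast
  qed
  from gdist_through[OF reach this] have "gdist G x w = gdist G x c + gdist G c w" .
  moreover have "gdist G c w = 1"
    using c w graph_symmetric by (intro gdist_adj) auto
  ultimately show ?thesis by (simp add: gdist_sym)
qed

text \<open>A walk that ends outside \<open>C\<close> has to leave \<open>C\<close>, and its exit
  arc ends in \<open>w\<close>.\<close>

lemma gdist_through_deleted:
  assumes C: "C \<in> components_minus G w" "x \<in> verts C" "y \<notin> verts C" and "x \<rightarrow>\<^sup>* y"
  shows "gdist G x y = gdist G x w + gdist G w y"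
proof (rule gdist_through[OF assms(4)])
  fix p assume p: "awalk x p y"
  obtain u v where "u \<in> verts C" "v \<notin> verts C" "u \<rightarrow> v" "v \<in> set (awalk_verts x p)"
    using awalk_leaves[OF p C(2,3)] by auto
  then show "w \<in> set (awalk_verts x p)"
    using component_minus_exit[OF C(1)] by blast
qed

text \<open>The diagonal terms may be included because the distance from a vertex to itself is
  0.\<close>

lemma double_pair_dist_sum:
  assumes "finite S" "S \<subseteq> verts G"
  shows "2 * pair_dist_sum G S = (\<Sum>x\<in>S. \<Sum>y\<in>S. gdist G x y)"
  unfolding pair_dist_sum_def sum_unordered_pairs[OF assms(1)]
  using assms(2) by (intro sum.cong refl) (auto simp: pair_dist_doubleton gdist_self)

end

theorem theorem3p1:
  fixes T :: "('a,'b) pre_digraph" and w :: 'a and m l :: nat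
    and nb :: "nat \<Rightarrow> 'a" and Ti :: "nat \<Rightarrow> ('a,'b) pre_digraph"
    and L :: "nat \<Rightarrow> 'a set" and li :: "nat \<Rightarrow> nat"
  assumes "undirected_tree T"
    and "card (verts T) \<ge> 3"
    and "w \<in> verts T" and "out_degree T w = m" and "m \<ge> 2"
    and "bij_betw nb {1..m} {v. w \<rightarrow>\<^bsub>T\<^esub> v}"
    and "bij_betw Ti {1..m} (components_minus T w)"
    and "\<And>i. i \<in> {1..m} \<Longrightarrow> nb i \<in> verts (Ti i)"
    and "l = card (pendents T)"
    and "\<And>i. i \<in> {1..m} \<Longrightarrow> L i = pendents T \<inter> verts (Ti i)"
    and "\<And>i. i \<in> {1..m} \<Longrightarrow> li i = card (L i)"
  shows "int (terminal_wiener T) =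
    (\<Sum>i = 1..m. int (pair_dist_sum T (L i))
       + (int l - int (li i)) * int (\<Sum>x\<in>L i. gdist T (nb i) x)
       - (int (li i))\<^sup>2)
    + (int l)\<^sup>2"
proof -
  interpret T: undirected_tree T by fact
  let ?I = "{1..m}"
  define d where "d i = (\<Sum>x\<in>L i. gdist T (nb i) x)" for i
  \<comment> \<open>The matrix of distances between pendent vertices is cut into blocks, one for
    each ordered pair of components.\<close>
  define B where "B i j = (\<Sum>x\<in>L i. \<Sum>y\<in>L j. gdist T x y)" for i j

  \<comment> \<open>Connectedness refers to the symmetric closure; as the arcs are symmetric
    already, it yields directed walks both ways.\<close>
  have reach: "x \<rightarrow>\<^sup>*\<^bsub>T\<^esub> y" if "x \<in> verts T" "y \<in> verts T" for x y
    using T.symmetric_connected_imp_strongly_connected[OF T.sym_arcs T.connected] that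
    by (auto simp: strongly_connected_def)
  have nb: "nb ` ?I = {v. w \<rightarrow>\<^bsub>T\<^esub> v}" and Ti: "Ti ` ?I = components_minus T w"
    using assms(6,7) by (simp_all add: bij_betw_def)
  have comp: "Ti i \<in> components_minus T w" if "i \<in> ?I" for i
    using Ti that by blast
  have disj: "verts (Ti i) \<inter> verts (Ti j) = {}" if "i \<in> ?I" "j \<in> ?I" "i \<noteq> j" for i j
  proof (rule T.components_minus_disjoint[OF comp comp])
    show "Ti i \<noteq> Ti j"
      using bij_betw_imp_inj_on[OF assms(7)] that by (simp add: inj_on_eq_iff)
  qed (use that in auto)
  have adj: "w \<rightarrow>\<^bsub>T\<^esub> nb i" if "i \<in> ?I" for i
    using nb that by blast
  have unique: "v = nb i" if "i \<in> ?I" "v \<in> verts (Ti i)" "w \<rightarrow>\<^bsub>T\<^esub> v" for i v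
  proof -
    from that(3) nb obtain k where k: "k \<in> ?I" "v = nb k"
      by blast
    with assms(8) disj that(1,2) have "k = i" by blast
    with k show ?thesis by simp
  qed
  have LV: "L i \<subseteq> verts (Ti i)" "L i \<subseteq> verts T" if "i \<in> ?I" for i
    using assms(10)[OF that] by (auto simp: pendents_def)
  have finL: "finite (L i)" if "i \<in> ?I" for i
    using LV(2)[OF that] by (rule finite_subset) simp

  have dist_w: "gdist T x w = gdist T (nb i) x + 1" if "i \<in> ?I" "x \<in> L i" for i x
    using that LV assms(3)
    by (intro T.gdist_to_deleted[OF comp _ assms(8) adj unique] reach) auto
  have cross: "B i j = li j * d i + li i * d j + 2 * li i * li j"
    if ij: "i \<in> ?I" "j \<in> ?I" "i \<noteq> j" for i j
  proof -
    have "gdist T x y = gdist T (nb i) x + (gdist T (nb j) y + 2)" if "x \<in> L i" "y \<in> L j" for x y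
    proof -
      have "gdist T x y = gdist T x w + gdist T w y"
        using that ij LV disj[OF ij] by (intro T.gdist_through_deleted[OF comp[OF ij(1)]] reach) blast+
      then show ?thesis
        using dist_w[OF ij(1) that(1)] dist_w[OF ij(2) that(2)] T.gdist_sym[of w y] by simp
    qed
    then have "B i j = (\<Sum>x\<in>L i. \<Sum>y\<in>L j. gdist T (nb i) x + (gdist T (nb j) y + 2))"
      unfolding B_def by (intro sum.cong refl) auto
    \<comment> \<open>Rewriting \<open>+ 2\<close> to \<open>Suc\<close> is switched off so that the
      constant remains a summand for \<open>sum.distrib\<close>.\<close>
    also have "\<dots> = li j * d i + li i * d j + 2 * li i * li j"
      using assms(11) ij by (simp add: sum.distrib d_def sum_distrib_left algebra_simps
        del: add_2_eq_Suc add_2_eq_Suc')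
    finally show ?thesis .
  qed
  have diag: "B i i = 2 * pair_dist_sum T (L i)" if "i \<in> ?I" for i
    unfolding B_def using T.double_pair_dist_sum[OF finL LV(2)] that by simp

  \<comment> \<open>Since \<open>w\<close> has degree at least 2, every pendent vertex lies in some
    component.\<close>
  have "w \<notin> pendents T"
    using assms(4,5) by (simp add: pendents_def)
  then have cover: "pendents T = (\<Union>i\<in>?I. L i)"
  proof (intro equalityI subsetI)
    fix x assume x: "x \<in> pendents T"
    with \<open>w \<notin> pendents T\<close> have "x \<in> verts T" "x \<noteq> w"
      by (auto simp: pendents_def)
    then obtain C where C: "C \<in> components_minus T w" "x \<in> verts C"
      by (rule T.components_minus_cover)
    from C(1) obtain i where i: "i \<in> ?I" "C = Ti i"
      unfolding Ti[symmetric] by (elim imageE)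
    with x C(2) assms(10) show "x \<in> (\<Union>i\<in>?I. L i)"
      by blast
  qed (use assms(10) in auto)
  have sum_pendents: "(\<Sum>x\<in>pendents T. f x) = (\<Sum>i\<in>?I. \<Sum>x\<in>L i. f x)" for f :: "'a \<Rightarrow> nat"
    unfolding cover
  proof (rule sum.UNION_disjoint)
    show "\<forall>i\<in>?I. \<forall>j\<in>?I. i \<noteq> j \<longrightarrow> L i \<inter> L j = {}"
      using LV(1) disj by blast
  qed (use finL in auto)
  have l: "l = (\<Sum>i\<in>?I. li i)"
    using sum_pendents[of "\<lambda>_. 1"] assms(9,11) by simp

  have "2 * terminal_wiener T = (\<Sum>x\<in>pendents T. \<Sum>y\<in>pendents T. gdist T x y)"
    unfolding terminal_wiener_def
    by (rule T.double_pair_dist_sum) (auto simp: pendents_def)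
  also have "\<dots> = (\<Sum>i\<in>?I. \<Sum>j\<in>?I. B i j)"
    \<comment> \<open>After both sums are split, the summation over \<open>x\<close> in
      \<open>L i\<close> has to move inside the one over \<open>j\<close>.\<close>
    unfolding sum_pendents B_def by (rule sum.cong[OF refl sum.swap])
  finally have "2 * int (terminal_wiener T) = (\<Sum>i\<in>?I. \<Sum>j\<in>?I. int (B i j))"
    by (simp flip: of_nat_sum)
  \<comment> \<open>The formula of \<open>cross\<close> is used for all blocks. For
    \<open>j = i\<close> it gives \<open>2 * li i * d i + 2 * (li i)\<^sup>2\<close> instead of
    twice the pair sum; the conditional term corrects this. The correction can be negative, hence
    the integers.\<close>
  also have "\<dots> = (\<Sum>i\<in>?I. \<Sum>j\<in>?I. int (li j * d i + li i * d j + 2 * li i * li j)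
      + (if j = i then 2 * (int (pair_dist_sum T (L i)) - int (li i) * int (d i) - (int (li i))\<^sup>2) else 0))"
    using cross diag by (intro sum.cong refl) (auto simp: power2_eq_square algebra_simps)
  also have "\<dots> = (\<Sum>i\<in>?I. \<Sum>j\<in>?I. int (li j) * int (d i)) + (\<Sum>i\<in>?I. \<Sum>j\<in>?I. int (li i) * int (d j))
      + 2 * (\<Sum>i\<in>?I. \<Sum>j\<in>?I. int (li i) * int (li j))
      + 2 * (\<Sum>i\<in>?I. int (pair_dist_sum T (L i)) - int (li i) * int (d i) - (int (li i))\<^sup>2)"
    by (simp add: sum.distrib sum_distrib_left mult.assoc)
  \<comment> \<open>The three double sums factor, with \<open>l\<close> as the sum of the
    \<open>li i\<close>. The first two agree, so everything is even and the factor 2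
    cancels.\<close>
  also have "(\<Sum>i\<in>?I. \<Sum>j\<in>?I. int (li j) * int (d i)) = int l * (\<Sum>i\<in>?I. int (d i))"
    by (subst sum.swap) (simp add: l sum_product)
  also have "(\<Sum>i\<in>?I. \<Sum>j\<in>?I. int (li i) * int (d j)) = int l * (\<Sum>i\<in>?I. int (d i))"
    by (simp add: l sum_product)
  also have "(\<Sum>i\<in>?I. \<Sum>j\<in>?I. int (li i) * int (li j)) = (int l)\<^sup>2"
    by (simp add: l sum_product power2_eq_square)
  finally have "int (terminal_wiener T) = int l * (\<Sum>i\<in>?I. int (d i))
      + (\<Sum>i\<in>?I. int (pair_dist_sum T (L i)) - int (li i) * int (d i) - (int (li i))\<^sup>2) + (int l)\<^sup>2"
    by simp
  \<comment> \<open>Moving \<open>l\<close> into the sum combines \<open>l * d i\<close> and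
    \<open>li i * d i\<close> into \<open>(l - li i) * d i\<close>.\<close>
  then show ?thesis
    unfolding d_def[symmetric]
    by (simp add: sum.distrib sum_subtractf sum_distrib_left algebra_simps)
qed

end
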